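(* Let $k,n$ be positive integers and let $c_1,\dots,c_n$ be non-negative integers with $n=c_1+2c_2+\cdots+nc_n$. Let $\mathbf c=(c_1,\dots,c_n)$. Then the coefficient of $\dfrac{t_1^{c_1}\cdots t_n^{c_n}}{c_1!\cdots c_n!}$ in the formal power series \[ \frac12\exp\Big(\sum_{\ell\ge1}\sum_{g\in G_k(\ell)}\frac{\ell^{g-1}}{g}t_\ell^{g}\Big)+\frac12\exp\Big(\sum_{\ell\ge1}\sum_{g\in G_k(\ell)}(-1)^{\ell g+1}\frac{\ell^{g-1}}{g}t_\ell^{g}\Big) \] equals the number of even $k$th roots in $S_n$ of a permutation of cycle type $\mathbf c$, and the coefficient of the same monomial in \[ \frac12\exp\Big(\sum_{\ell\ge1}\sum_{g\in G_k(\ell)}\frac{\ell^{g-1}}{g}t_\ell^{g}\Big)-\frac12\exp\Big(\sum_{\ell\ge1}\sum_{g\in G_k(\ell)}(-1)^{\ell g+1}\frac{\ell^{g-1}}{g}t_\ell^{g}\Big) \] equals the number of odd $k$th roots in $S_n$ of a permutation of cycle type $\mathbf c$.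
   Context: For positive integers $k,\ell$, $G_k(\ell)=\{g\in\mathbb N:\gcd(g\ell,k)=g\}$ (a finite set of divisors of $k$). The cycle type of a permutation $\sigma\in S_n$ is the vector $(c_1,\dots,c_n)$ where $c_i$ is the number of cycles of length $i$ (fixed points counted as $1$-cycles) in the disjoint cycle decomposition of $\sigma$. A $k$th root of $\sigma\in S_n$ is a permutation $\tau\in S_n$ with $\tau^k=\sigma$; it is an even (resp. odd) $k$th root if $\tau$ is an even (resp. odd) permutation. The series are formal power series in the infinitely many variables $t_1,t_2,\dots$. *)

theory Defs
  imports Complex_Main "HOL-Library.Poly_Mapping" "HOL-Combinatorics.Combinatorics"
begin

text \<open>Formal power series in the variables t_0, t_1, t_2, ... (t_0 unused) with real
coefficients: a series is its coefficient function on monomials, a monomial being a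
finitely supported exponent vector of type nat to nat (poly mapping).\<close>

type_synonym mfps = "(nat \<Rightarrow>\<^sub>0 nat) \<Rightarrow> real"

definition mfps_one :: mfps where
  "mfps_one = (\<lambda>\<alpha>. if \<alpha> = 0 then 1 else 0)"

definition mfps_mult :: "mfps \<Rightarrow> mfps \<Rightarrow> mfps" where
  "mfps_mult f g = (\<lambda>\<alpha>. \<Sum>(\<beta>, \<gamma>) \<in> {(\<beta>, \<gamma>). \<beta> + \<gamma> = \<alpha>}. f \<beta> * g \<gamma>)"

fun mfps_pow :: "mfps \<Rightarrow> nat \<Rightarrow> mfps" where
  "mfps_pow f 0 = mfps_one"
| "mfps_pow f (Suc m) = mfps_mult f (mfps_pow f m)"

text \<open>exp F = sum over m of F^m / m!, coefficientwise (F has zero constant term in all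
uses below, so each coefficient sequence is eventually zero).\<close>
definition mfps_exp :: "mfps \<Rightarrow> mfps" where
  "mfps_exp f = (\<lambda>\<alpha>. suminf (\<lambda>m. mfps_pow f m \<alpha> / fact m))"

definition G :: "nat \<Rightarrow> nat \<Rightarrow> nat set" where
  "G k l = {g. g \<ge> 1 \<and> gcd (g * l) k = g}"

definition root_exponent :: "nat \<Rightarrow> (nat \<Rightarrow> nat \<Rightarrow> real) \<Rightarrow> mfps" where
  "root_exponent k s = (\<lambda>\<alpha>. \<Sum>(l, g) \<in> {(l, g). l \<ge> 1 \<and> g \<in> G k l \<and> Poly_Mapping.single l g = \<alpha>}.
       s l g * real l ^ (g - 1) / real g)"

definition F_plus :: "nat \<Rightarrow> mfps" where
  "F_plus k = root_exponent k (\<lambda>l g. 1)"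

definition F_minus :: "nat \<Rightarrow> mfps" where
  "F_minus k = root_exponent k (\<lambda>l g. (-1) ^ (l * g + 1))"

definition monom :: "nat \<Rightarrow> (nat \<Rightarrow> nat) \<Rightarrow> (nat \<Rightarrow>\<^sub>0 nat)" where
  "monom n c = (\<Sum>i\<in>{1..n}. Poly_Mapping.single i (c i))"

definition egf_coeff :: "mfps \<Rightarrow> nat \<Rightarrow> (nat \<Rightarrow> nat) \<Rightarrow> real" where
  "egf_coeff f n c = (\<Prod>i\<in>{1..n}. fact (c i)) * f (monom n c)"

text \<open>Cycles of a permutation of {1..n}: its orbits (fixed points are 1-cycles).
Cycle type: c_i = number of cycles of length i, for i = 1..n.\<close>
definition cycles_of :: "nat \<Rightarrow> (nat \<Rightarrow> nat) \<Rightarrow> nat set set" where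
  "cycles_of n \<sigma> = {orbit \<sigma> x | x. x \<in> {1..n}}"

definition has_cycle_type :: "nat \<Rightarrow> (nat \<Rightarrow> nat) \<Rightarrow> (nat \<Rightarrow> nat) \<Rightarrow> bool" where
  "has_cycle_type n \<sigma> c \<longleftrightarrow> (\<forall>i\<in>{1..n}. card {C \<in> cycles_of n \<sigma>. card C = i} = c i)"

end

theory Submission
  imports Defs "HOL-Number_Theory.Cong"
begin

text \<open>Let \<open>x\<close> lie in a cycle of \<open>\<sigma>\<close> of length \<open>l\<close>, and let \<open>\<tau>\<close> be a \<open>k\<close>th root of \<open>\<sigma>\<close>. The cycle of
  \<open>\<tau>\<close> through \<open>x\<close> fuses \<open>g\<close> cycles of \<open>\<sigma>\<close> of length \<open>l\<close>, where \<open>g\<close> lies in \<open>G k l\<close>, and it is determined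
  by the points \<open>x, \<tau> x, \<dots>, \<tau>\<^sup>g\<^sup>-\<^sup>1 x\<close>, which may be arbitrary points of distinct cycles of length \<open>l\<close>.
  Removing this cycle leaves a \<open>k\<close>th root of the rest of \<open>\<sigma>\<close> and changes the sign by
  \<open>(-1)\<^sup>l\<^sup>g\<^sup>+\<^sup>1\<close>. The resulting recurrence for the (signed) number of roots is the one that the
  operators \<open>t\<^sub>l \<partial>/\<partial>t\<^sub>l\<close> give for the coefficients of the exponentials.\<close>

subsection \<open>Exponentials of multivariate power series\<close>

text \<open>Both summands are dominated pointwise by \<open>\<alpha>\<close>, hence come from a
  finite set of functions on its support. Over an infinite index set the sum in
  \<open>mfps_mult\<close> would default to 0.\<close>

lemma finite_decompositions:
  fixes \<alpha> :: "'a \<Rightarrow>\<^sub>0 nat"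
  shows "finite {(\<beta>, \<gamma>). \<beta> + \<gamma> = \<alpha>}"
proof -
  define M where "M = Max (insert 0 (Poly_Mapping.lookup \<alpha> ` Poly_Mapping.keys \<alpha>))"
  define P where "P = {f. \<forall>x. (x \<in> Poly_Mapping.keys \<alpha> \<longrightarrow> f x \<in> {..M}) \<and> (x \<notin> Poly_Mapping.keys \<alpha> \<longrightarrow> f x = 0)}"
  have fin: "finite P"
    unfolding P_def by (rule finite_set_of_finite_funs) simp_all
  have *: "Poly_Mapping.lookup \<beta> \<in> P"
    if le: "\<And>x. Poly_Mapping.lookup \<beta> x \<le> Poly_Mapping.lookup \<alpha> x" for \<beta>
  proof -
    have "Poly_Mapping.lookup \<beta> x \<le> M" if "x \<in> Poly_Mapping.keys \<alpha>" for x
      unfolding M_def using that by (intro order.trans[OF le] Max_ge) simp_all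
    moreover have "Poly_Mapping.lookup \<beta> x = 0" if "x \<notin> Poly_Mapping.keys \<alpha>" for x
      using le[of x] that by (simp add: not_in_keys_iff_lookup_eq_zero)
    ultimately show ?thesis by (simp add: P_def)
  qed
  have "inj Poly_Mapping.lookup"
    by (rule injI) (simp only: poly_mapping_eq_iff)
  then have "finite (Poly_Mapping.lookup -` P)"
    by (rule finite_vimageI[OF fin])
  then have "finite ((Poly_Mapping.lookup -` P) \<times> (Poly_Mapping.lookup -` P))" by blast
  moreover have "{(\<beta>, \<gamma>). \<beta> + \<gamma> = \<alpha>} \<subseteq> (Poly_Mapping.lookup -` P) \<times> (Poly_Mapping.lookup -` P)"
    using * by (auto simp: lookup_add)
  ultimately show ?thesis by (rule rev_finite_subset)
qed

lemma mfps_mult_left_commute: "mfps_mult f (mfps_mult g h) = mfps_mult g (mfps_mult f h)"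
proof
  fix \<alpha>
  have expand: "mfps_mult f (mfps_mult g h) \<alpha>
      = (\<Sum>(p, q)\<in>(SIGMA p:{(\<beta>, \<gamma>). \<beta> + \<gamma> = \<alpha>}. {(\<beta>, \<gamma>). \<beta> + \<gamma> = snd p}).
           f (fst p) * g (fst q) * h (snd q))" for f g
    unfolding mfps_mult_def
    by (subst sum.Sigma [symmetric])
       (auto simp: finite_decompositions sum_distrib_left case_prod_beta mult.assoc intro!: sum.cong)
  show "mfps_mult f (mfps_mult g h) \<alpha> = mfps_mult g (mfps_mult f h) \<alpha>"
    unfolding expand
    \<comment> \<open>A term is a triple with \<open>a + c + d = \<alpha>\<close>, where
      \<open>b\<close> is \<open>c + d\<close>. The involution swaps \<open>a\<close> and
      \<open>c\<close>.\<close>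
    by (rule sum.reindex_bij_witness[
          where i = "\<lambda>((a, b), (c, d)). ((c, a + d), (a, d))" and j = "\<lambda>((a, b), (c, d)). ((c, a + d), (a, d))"])
       (auto simp: add_ac)
qed

text \<open>The Euler operator \<open>t\<^sub>l \<partial>/\<partial>t\<^sub>l\<close>.\<close>

definition mfps_deriv :: "nat \<Rightarrow> mfps \<Rightarrow> mfps" where
  "mfps_deriv l f = (\<lambda>\<alpha>. real (Poly_Mapping.lookup \<alpha> l) * f \<alpha>)"

lemma mfps_deriv_mult:
  "mfps_deriv l (mfps_mult f g) = (\<lambda>\<alpha>. mfps_mult (mfps_deriv l f) g \<alpha> + mfps_mult f (mfps_deriv l g) \<alpha>)"
  unfolding mfps_deriv_def mfps_mult_def
  by (rule ext) (auto simp: sum_distrib_left lookup_add algebra_simps simp flip: sum.distrib intro!: sum.cong)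

text \<open>The Leibniz rule splits off one factor; left commutativity then brings
  \<open>mfps_deriv l f\<close> in front of the remaining \<open>f\<close>.\<close>

lemma mfps_deriv_pow:
  "mfps_deriv l (mfps_pow f (Suc m)) = (\<lambda>\<alpha>. real (Suc m) * mfps_mult (mfps_deriv l f) (mfps_pow f m) \<alpha>)"
proof (induction m)
  case 0
  have "mfps_deriv l mfps_one = (\<lambda>\<alpha>. 0)"
    by (auto simp: mfps_deriv_def mfps_one_def)
  then show ?case
    by (simp add: mfps_deriv_mult) (simp add: mfps_mult_def)
next
  case (Suc m)
  have scale: "mfps_mult f (\<lambda>\<alpha>. c * g \<alpha>) = (\<lambda>\<alpha>. c * mfps_mult f g \<alpha>)" for c g
    by (auto simp: mfps_mult_def sum_distrib_left mult.left_commute intro!: ext sum.cong)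
  have "mfps_deriv l (mfps_pow f (Suc (Suc m)))
     = (\<lambda>\<alpha>. mfps_mult (mfps_deriv l f) (mfps_pow f (Suc m)) \<alpha>
         + mfps_mult f (mfps_deriv l (mfps_pow f (Suc m))) \<alpha>)"
    by (subst mfps_pow.simps(2)) (rule mfps_deriv_mult)
  also have "mfps_mult f (mfps_deriv l (mfps_pow f (Suc m)))
      = (\<lambda>\<alpha>. real (Suc m) * mfps_mult (mfps_deriv l f) (mfps_pow f (Suc m)) \<alpha>)"
    unfolding Suc.IH by (simp add: scale mfps_mult_left_commute[of f "mfps_deriv l f"])
  finally show ?case
    by (simp add: algebra_simps)
qed

definition total_degree :: "(nat \<Rightarrow>\<^sub>0 nat) \<Rightarrow> nat" where
  "total_degree \<alpha> = (\<Sum>i\<in>Poly_Mapping.keys \<alpha>. Poly_Mapping.lookup \<alpha> i)"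

lemma total_degree_add: "total_degree (\<alpha> + \<beta>) = total_degree \<alpha> + total_degree \<beta>"
  unfolding total_degree_def by (rule setsum_keys_plus_distrib) auto

lemma total_degree_eq_0_iff: "total_degree \<alpha> = 0 \<longleftrightarrow> \<alpha> = 0"
proof
  assume "total_degree \<alpha> = 0"
  then have "Poly_Mapping.lookup \<alpha> i = 0" for i
    by (auto simp: total_degree_def in_keys_iff)
  then show "\<alpha> = 0" by (intro poly_mapping_eqI) simp
qed (simp add: total_degree_def)

text \<open>Each of the \<open>m\<close> factors contributes a monomial of degree at least 1, since
  \<open>f\<close> has no constant term.\<close>

lemma mfps_pow_eq_0:
  assumes "f 0 = 0" and "total_degree \<alpha> < m"
  shows "mfps_pow f m \<alpha> = 0"
  using assms(2)
proof (induction m arbitrary: \<alpha>)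
  case (Suc m)
  have "f \<beta> * mfps_pow f m \<gamma> = 0" if "\<beta> + \<gamma> = \<alpha>" for \<beta> \<gamma>
  proof (cases "\<beta> = 0")
    case False
    then have "total_degree \<beta> > 0" using total_degree_eq_0_iff[of \<beta>] by simp
    then have "total_degree \<gamma> < m"
      using Suc.prems that total_degree_add[of \<beta> \<gamma>] by simp
    then show ?thesis using Suc.IH by simp
  qed (simp add: assms(1))
  then show ?case
    by (auto simp: mfps_mult_def intro!: sum.neutral)
qed simp

lemma mfps_exp_sums:
  assumes "f 0 = 0"
  shows "(\<lambda>m. mfps_pow f m \<alpha> / fact m) sums mfps_exp f \<alpha>"
  unfolding mfps_exp_def
  by (rule summable_sums, rule summable_finite[of "{..total_degree \<alpha>}"])
     (auto simp: mfps_pow_eq_0[of f, OF assms])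

lemma mfps_exp_0:
  assumes "f 0 = 0"
  shows "mfps_exp f 0 = 1"
proof -
  have "(\<lambda>m. mfps_pow f m 0 / fact m) sums (\<Sum>m\<in>{0}. mfps_pow f m 0 / fact m)"
    by (rule sums_finite) (auto intro!: mfps_pow_eq_0[of f, OF assms] simp: total_degree_def)
  then have "(\<lambda>m. mfps_pow f m 0 / fact m) sums 1"
    by (simp add: mfps_one_def)
  then show ?thesis
    by (rule sums_unique2[OF mfps_exp_sums[of f, OF assms]])
qed

text \<open>Differentiating termwise shifts the exponential series by one index: the factor
  \<open>Suc m\<close> of the power rule cancels against \<open>fact (Suc m)\<close>, and the term
  at index 0 vanishes.\<close>

lemma mfps_deriv_exp:
  assumes "f 0 = 0"
  shows "mfps_deriv l (mfps_exp f) = mfps_mult (mfps_deriv l f) (mfps_exp f)"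
proof
  fix \<alpha>
  let ?a = "\<lambda>m. real (Poly_Mapping.lookup \<alpha> l) * (mfps_pow f m \<alpha> / fact m)"
  have "(\<lambda>m. \<Sum>(\<beta>, \<gamma>)\<in>{(\<beta>, \<gamma>). \<beta> + \<gamma> = \<alpha>}. mfps_deriv l f \<beta> * (mfps_pow f m \<gamma> / fact m))
      sums (\<Sum>(\<beta>, \<gamma>)\<in>{(\<beta>, \<gamma>). \<beta> + \<gamma> = \<alpha>}. mfps_deriv l f \<beta> * mfps_exp f \<gamma>)"
    unfolding case_prod_beta by (intro sums_sum sums_mult mfps_exp_sums[of f, OF assms])
  then have "(\<lambda>m. mfps_mult (mfps_deriv l f) (mfps_pow f m) \<alpha> / fact m)
      sums mfps_mult (mfps_deriv l f) (mfps_exp f) \<alpha>"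
    by (simp add: mfps_mult_def sum_divide_distrib case_prod_beta)
  moreover have "?a (Suc m) = mfps_mult (mfps_deriv l f) (mfps_pow f m) \<alpha> / fact m" for m
    using fun_cong[OF mfps_deriv_pow[of l f m], of \<alpha>]
    by (simp add: mfps_deriv_def del: mfps_pow.simps of_nat_Suc)
  ultimately have shifted: "(\<lambda>m. ?a (Suc m)) sums mfps_mult (mfps_deriv l f) (mfps_exp f) \<alpha>"
    by simp
  have "?a 0 = 0" by (simp add: mfps_one_def)
  with sums_Suc[OF shifted] have "?a sums mfps_mult (mfps_deriv l f) (mfps_exp f) \<alpha>"
    by (simp only: add_0_right)
  moreover have "?a sums mfps_deriv l (mfps_exp f) \<alpha>"
    unfolding mfps_deriv_def by (intro sums_mult mfps_exp_sums[of f, OF assms])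
  ultimately show "mfps_deriv l (mfps_exp f) \<alpha> = mfps_mult (mfps_deriv l f) (mfps_exp f) \<alpha>"
    by (rule sums_unique2[symmetric])
qed

section \<open>The exponent series and the recurrence for its exponential\<close>

lemma single_nat_eq_iff:
  fixes g h :: nat
  assumes "g > 0"
  shows "Poly_Mapping.single m h = Poly_Mapping.single l g \<longleftrightarrow> m = l \<and> h = g"
proof
  assume eq: "Poly_Mapping.single m h = Poly_Mapping.single l g"
  then have "Poly_Mapping.lookup (Poly_Mapping.single m h) l = g"
    by simp
  then show "m = l \<and> h = g"
    using assms by (auto simp: lookup_single when_def split: if_splits)
qed simp

lemma root_exponent_single:
  assumes "l \<ge> 1" and "g \<in> G k l"
  shows "root_exponent k s (Poly_Mapping.single l g) = s l g * real l ^ (g - 1) / real g"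
proof -
  \<comment> \<open>Positivity of \<open>g\<close> makes the monomial determine the pair;
    \<open>Poly_Mapping.single m 0\<close> is 0 for every \<open>m\<close>.\<close>
  have "{(m, h). m \<ge> 1 \<and> h \<in> G k m \<and> Poly_Mapping.single m h = Poly_Mapping.single l g} = {(l, g)}"
    using assms by (auto simp: single_nat_eq_iff G_def)
  then show ?thesis by (simp add: root_exponent_def)
qed

lemma root_exponent_nonzero_imp_single:
  assumes "root_exponent k s \<alpha> \<noteq> 0"
  obtains l g where "l \<ge> 1" "g \<in> G k l" "\<alpha> = Poly_Mapping.single l g"
  using assms unfolding root_exponent_def
  by (auto elim!: sum.not_neutral_contains_not_neutral)

lemma root_exponent_0: "root_exponent k s 0 = 0"
proof (rule ccontr)
  assume "root_exponent k s 0 \<noteq> 0"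
  then obtain l g where "g \<in> G k l" and eq: "0 = Poly_Mapping.single l g"
    by (rule root_exponent_nonzero_imp_single)
  moreover have "g = 0"
    using arg_cong[OF eq, of "\<lambda>\<alpha>. Poly_Mapping.lookup \<alpha> l"] by simp
  ultimately show False by (simp add: G_def)
qed

lemma finite_G: "k \<ge> 1 \<Longrightarrow> finite (G k l)"
proof (rule finite_subset[of _ "{..k}"])
  assume "k \<ge> 1"
  then have "gcd m k \<le> k" for m
    by (intro dvd_imp_le gcd_dvd2) simp
  then show "G k l \<subseteq> {..k}"
    by (auto simp: G_def) metis
qed simp

text \<open>Compare coefficients in the differential equation of the exponential. The Euler operator
  keeps only the powers of the variable with index \<open>l\<close>, and the factor \<open>g\<close>
  it yields cancels the denominator \<open>g\<close>.\<close>

lemma exp_root_exponent_recurrence: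
  assumes "k \<ge> 1" and "l \<ge> 1"
  shows "real (Poly_Mapping.lookup \<alpha> l) * mfps_exp (root_exponent k s) \<alpha>
    = (\<Sum>g\<in>{g \<in> G k l. g \<le> Poly_Mapping.lookup \<alpha> l}.
         s l g * real l ^ (g - 1) * mfps_exp (root_exponent k s) (\<alpha> - Poly_Mapping.single l g))"
proof -
  let ?F = "root_exponent k s" and ?E = "mfps_exp (root_exponent k s)"
  let ?T = "{g \<in> G k l. g \<le> Poly_Mapping.lookup \<alpha> l}"
  let ?i = "\<lambda>g. (Poly_Mapping.single l g, \<alpha> - Poly_Mapping.single l g)"
  have split: "Poly_Mapping.single l g + (\<alpha> - Poly_Mapping.single l g) = \<alpha>" if "g \<le> Poly_Mapping.lookup \<alpha> l" for g
    using that by (intro poly_mapping_eqI) (auto simp: lookup_add lookup_minus lookup_single when_def)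
  have zero: "mfps_deriv l ?F \<beta> * ?E \<gamma> = 0"
    if "\<beta> + \<gamma> = \<alpha>" "(\<beta>, \<gamma>) \<notin> ?i ` ?T" for \<beta> \<gamma>
  proof (rule ccontr)
    assume "mfps_deriv l ?F \<beta> * ?E \<gamma> \<noteq> 0"
    then have nz: "Poly_Mapping.lookup \<beta> l \<noteq> 0" "?F \<beta> \<noteq> 0" by (auto simp: mfps_deriv_def)
    from nz(2) obtain m g where g: "g \<in> G k m" "\<beta> = Poly_Mapping.single m g"
      by (rule root_exponent_nonzero_imp_single)
    with nz(1) have "m = l" by (metis lookup_single_not_eq)
    moreover have "\<gamma> = \<alpha> - \<beta>"
      using that(1) by (intro poly_mapping_eqI) (auto simp: lookup_add lookup_minus)
    moreover have "Poly_Mapping.lookup \<beta> l \<le> Poly_Mapping.lookup \<alpha> l"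
      using that(1) by (auto simp: lookup_add)
    ultimately show False using g that(2) by auto
  qed
  have "real (Poly_Mapping.lookup \<alpha> l) * ?E \<alpha> = mfps_mult (mfps_deriv l ?F) ?E \<alpha>"
    using fun_cong[OF mfps_deriv_exp[of ?F l, OF root_exponent_0], of \<alpha>] by (simp add: mfps_deriv_def)
  also have "\<dots> = (\<Sum>(\<beta>, \<gamma>)\<in>?i ` ?T. mfps_deriv l ?F \<beta> * ?E \<gamma>)"
    unfolding mfps_mult_def
    by (rule sum.mono_neutral_right[OF finite_decompositions]) (use split zero in auto)
  also have "\<dots> = (\<Sum>g\<in>?T. mfps_deriv l ?F (Poly_Mapping.single l g) * ?E (\<alpha> - Poly_Mapping.single l g))"
    by (subst sum.reindex) (auto simp: inj_on_def dest: injD[OF inj_single])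
  also have "\<dots> = (\<Sum>g\<in>?T. s l g * real l ^ (g - 1) * ?E (\<alpha> - Poly_Mapping.single l g))"
    by (rule sum.cong) (use assms(2) in \<open>auto simp: mfps_deriv_def root_exponent_single G_def\<close>)
  finally show ?thesis .
qed

subsection \<open>Cycles of roots\<close>

lemma card_orbit_eq_least_power:
  assumes "permutation f"
  shows "card (orbit f x) = least_power f x"
proof -
  have "orbit f x = set (support f x)"
    unfolding support_set[OF assms] orbit_altdef_permutation[OF assms] by auto
  then show ?thesis
    using distinct_card[OF cycle_of_permutation[OF assms, of x]] by simp
qed

lemma card_orbit_pos:
  assumes "permutation f"
  shows "card (orbit f x) > 0"
  using least_power_of_permutation(2)[OF assms] card_orbit_eq_least_power[OF assms] by simp

text \<open>Injectivity cancels the smaller power. What remains is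
  \<open>(f ^^ (b - a)) x = x\<close>, a divisibility by the cycle length.\<close>

lemma funpow_eq_iff_mod_card_orbit:
  assumes "permutation f"
  shows "(f ^^ a) x = (f ^^ b) x \<longleftrightarrow> a mod card (orbit f x) = b mod card (orbit f x)"
proof -
  have inj: "inj (f ^^ n)" for n
    using assms by (intro inj_fn bij_is_inj permutation_bijective)
  have main: "(f ^^ a) x = (f ^^ b) x \<longleftrightarrow> a mod card (orbit f x) = b mod card (orbit f x)" if "a \<le> b" for a b
  proof -
    have "(f ^^ b) x = (f ^^ a) ((f ^^ (b - a)) x)"
      using that funpow_add[of a "b - a" f] by simp
    then have "(f ^^ a) x = (f ^^ b) x \<longleftrightarrow> (f ^^ (b - a)) x = x"
      using inj_eq[OF inj, of a x "(f ^^ (b - a)) x"] by metis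
    also have "\<dots> \<longleftrightarrow> card (orbit f x) dvd b - a"
      by (simp add: least_power_dvd[OF assms] card_orbit_eq_least_power[OF assms])
    also have "\<dots> \<longleftrightarrow> a mod card (orbit f x) = b mod card (orbit f x)"
      using mod_eq_dvd_iff_nat[OF that, of "card (orbit f x)"] by auto
    finally show ?thesis .
  qed
  show ?thesis
    using main[of a b] main[of b a] by (cases "a \<le> b") auto
qed

lemma orbit_eq_orbit:
  assumes "permutation f" and "y \<in> orbit f x"
  shows "orbit f y = orbit f x"
  by (rule orbit_cyclic_eq3[OF cyclic_on_orbit'[OF assms(1)] assms(2)])

lemma funpow_in_own_orbit:
  assumes "permutation f"
  shows "(f ^^ n) x \<in> orbit f x"
  using orbit_altdef_permutation[OF assms] by auto

text \<open>\<open>?l\<close> and \<open>?m div ?g\<close> have the same multiples \<open>a\<close>,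
  namely those with \<open>?m dvd k * a\<close>, and therefore coincide.\<close>

lemma card_orbit_funpow_gcd:
  assumes "permutation f"
  shows "card (orbit (f ^^ k) x) * gcd (card (orbit f x)) k = card (orbit f x)"
proof -
  let ?m = "card (orbit f x)" and ?l = "card (orbit (f ^^ k) x)"
  let ?g = "gcd ?m k"
  have m: "?m > 0" by (rule card_orbit_pos[OF assms])
  have "?l dvd a \<longleftrightarrow> ?m div ?g dvd a" for a
  proof -
    have "?l dvd a \<longleftrightarrow> ?m dvd k * a"
      using funpow_eq_iff_mod_card_orbit[OF permutation_funpow[OF assms, of k], of a x 0]
        funpow_eq_iff_mod_card_orbit[OF assms, of "k * a" x 0]
      by (simp add: funpow_mult dvd_eq_mod_eq_0)
    also have "\<dots> \<longleftrightarrow> (?m div ?g) * ?g dvd (k div ?g * a) * ?g"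
      by (simp add: mult.commute[of _ ?g] mult.assoc[symmetric])
    also have "\<dots> \<longleftrightarrow> ?m div ?g dvd (k div ?g) * a"
      by (rule dvd_times_right_cancel_iff) (use m in simp)
    also have "\<dots> \<longleftrightarrow> ?m div ?g dvd a"
      using div_gcd_coprime[of ?m k] m by (intro coprime_dvd_mult_right_iff) auto
    finally show ?thesis .
  qed
  from this[of ?l] this[of "?m div ?g"] have "?l = ?m div ?g"
    by (intro dvd_antisym) simp_all
  then show ?thesis by simp
qed

text \<open>A cycle through \<open>n\<close> points is a product of \<open>n - 1\<close>
  transpositions; each induction step peels off one.\<close>

lemma evenperm_cycle_of_list:
  assumes "distinct cs" and "cs \<noteq> []"
  shows "evenperm (cycle_of_list cs) \<longleftrightarrow> odd (length cs)"
  using assms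
proof (induction cs rule: cycle_of_list.induct)
  case (1 i j cs)
  have "evenperm (transpose i j \<circ> cycle_of_list (j # cs))
      \<longleftrightarrow> evenperm (transpose i j) = evenperm (cycle_of_list (j # cs))"
    by (rule evenperm_comp[OF permutation_swap_id permutation_of_cycle])
  also have "\<dots> \<longleftrightarrow> odd (length (i # j # cs))"
    using 1 by (simp add: evenperm_swap)
  finally show ?case unfolding cycle_of_list.simps(1) .
qed auto

section \<open>Cycles of a root and the points that determine them\<close>

lemma G_props:
  assumes "g \<in> G k l" and "k \<ge> 1"
  shows "g \<ge> 1" and "g * (k div g) = k" and "\<exists>j. (j * (k div g)) mod l = 1 mod l"
proof -
  from assms have g: "g \<ge> 1" "gcd (g * l) k = g" by (auto simp: G_def)
  then have "g dvd k" by (metis gcd_dvd2)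
  then show k: "g * (k div g) = k" by simp
  \<comment> \<open>Dividing \<open>gcd (g * l) k = g\<close> by \<open>g\<close> leaves
    \<open>k div g\<close> coprime to \<open>l\<close>, and \<open>j\<close> is its inverse modulo
    \<open>l\<close>. The form \<open>1 mod l\<close> covers \<open>l = 1\<close>.\<close>
  have "g * gcd l (k div g) = gcd (g * l) (g * (k div g))"
    by (simp add: gcd_mult_distrib_nat)
  with g k have "coprime (k div g) l"
    by (simp add: coprime_iff_gcd_eq_1 gcd.commute)
  then obtain j where "[k div g * j = Suc 0] (mod l)"
    using cong_solve_coprime_nat by blast
  then show "\<exists>j. (j * (k div g)) mod l = 1 mod l"
    by (auto simp: cong_def mult.commute)
  show "g \<ge> 1" by (fact g(1))
qed

text \<open>Within a cycle of length \<open>g * l\<close> of a \<open>k\<close>th root, the \<open>g\<close>th power is already a power of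
  \<open>\<sigma>\<close>, because \<open>k div g\<close> is invertible modulo \<open>l\<close>; hence the first \<open>g\<close> points determine the
  whole cycle.\<close>

lemma root_funpow_add:
  assumes "permutation \<tau>" and "card (orbit \<tau> x) = g * l"
    and "g * k' = k" and "(j * k') mod l = 1 mod l"
    and root: "\<And>i. (\<tau> ^^ k) ((\<tau> ^^ i) x) = \<sigma> ((\<tau> ^^ i) x)"
  shows "(\<tau> ^^ (i + g)) x = (\<sigma> ^^ j) ((\<tau> ^^ i) x)"
proof -
  have pow: "(\<sigma> ^^ n) ((\<tau> ^^ i) x) = (\<tau> ^^ (k * n + i)) x" for n
  proof (induction n)
    case (Suc n)
    have "(\<sigma> ^^ Suc n) ((\<tau> ^^ i) x) = (\<tau> ^^ k) ((\<tau> ^^ (k * n + i)) x)"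
      using Suc root by simp
    also have "\<dots> = (\<tau> ^^ (k + (k * n + i))) x"
      by (simp only: funpow_add comp_apply)
    finally show ?case by (simp add: add.assoc)
  qed simp
  \<comment> \<open>Multiplying \<open>j * k' = 1\<close> modulo \<open>l\<close> by
    \<open>g\<close> gives \<open>k * j = g\<close> modulo the cycle length
    \<open>g * l\<close>.\<close>
  have "(k * j) mod (g * l) = (g * (j * k')) mod (g * l)"
    using assms(3) by (auto simp: mult_ac)
  also have "\<dots> = g mod (g * l)"
    using assms(4) mult_mod_right[of g "j * k'" l] mult_mod_right[of g 1 l] by simp
  finally have "(k * j + i) mod (g * l) = (i + g) mod (g * l)"
    by (metis add.commute mod_add_left_eq)
  then show ?thesis
    using funpow_eq_iff_mod_card_orbit[OF assms(1), of "k * j + i" x "i + g"] assms(2) pow by simp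
qed

text \<open>The root property is asked for only along the orbits of \<open>x\<close>, because the
  lemma serves to compare a root with a single cycle \<open>\<rho>\<close>, which is a root of
  \<open>\<sigma>\<close> only there.\<close>

lemma root_determined_by_prefix:
  assumes "permutation \<tau>" "permutation \<rho>"
    and "card (orbit \<tau> x) = g * l" "card (orbit \<rho> x) = g * l"
    and "g \<in> G k l" "k \<ge> 1"
    and "\<And>i. (\<tau> ^^ k) ((\<tau> ^^ i) x) = \<sigma> ((\<tau> ^^ i) x)"
    and "\<And>i. (\<rho> ^^ k) ((\<rho> ^^ i) x) = \<sigma> ((\<rho> ^^ i) x)"
    and prefix: "\<And>i. i < g \<Longrightarrow> (\<tau> ^^ i) x = (\<rho> ^^ i) x"
  shows "(\<tau> ^^ i) x = (\<rho> ^^ i) x"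
proof -
  note g = G_props[OF assms(5,6)]
  from g(3) obtain j where j: "(j * (k div g)) mod l = 1 mod l" by blast
  show ?thesis
  proof (induction i rule: less_induct)
    case (less i)
    show ?case
    proof (cases "i < g")
      case False
      then have i: "i = (i - g) + g" by simp
      have "(\<tau> ^^ i) x = (\<sigma> ^^ j) ((\<tau> ^^ (i - g)) x)"
        by (subst i, rule root_funpow_add[OF assms(1,3) g(2) j assms(7)])
      also have "(\<tau> ^^ (i - g)) x = (\<rho> ^^ (i - g)) x"
        using less[of "i - g"] False g(1) by simp
      also have "(\<sigma> ^^ j) ((\<rho> ^^ (i - g)) x) = (\<rho> ^^ i) x"
        by (subst (2) i, rule root_funpow_add[OF assms(2,4) g(2) j assms(8), symmetric])
      finally show ?thesis .
    qed (rule prefix)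
  qed
qed

text \<open>The candidates for \<open>[x, \<tau> x, \<dots>, \<tau>\<^sup>g\<^sup>-\<^sup>1 x]\<close>, where \<open>\<tau>\<close> is a root of \<open>\<sigma>\<close> whose cycle
  through \<open>x\<close> fuses \<open>g\<close> cycles of \<open>\<sigma>\<close>.\<close>

definition start_lists :: "'a set \<Rightarrow> ('a \<Rightarrow> 'a) \<Rightarrow> 'a \<Rightarrow> nat \<Rightarrow> 'a list set" where
  "start_lists A \<sigma> x g = {ys. length ys = g \<and> ys ! 0 = x \<and> distinct (map (orbit \<sigma>) ys)
     \<and> set ys \<subseteq> {y \<in> A. card (orbit \<sigma> y) = card (orbit \<sigma> x)}}"

text \<open>By \<open>card_orbit_funpow_gcd\<close>, \<open>g\<close> is the gcd of the cycle length
  and \<open>k\<close>. As \<open>g\<close> divides both, exponents \<open>i, i' < g\<close> leading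
  into one cycle of \<open>\<tau> ^^ k\<close> are congruent modulo \<open>g\<close>, hence
  equal.\<close>

lemma root_start_list:
  assumes "\<tau> permutes A" and "finite A" and "x \<in> A" and "k \<ge> 1"
    and m: "card (orbit \<tau> x) = g * card (orbit (\<tau> ^^ k) x)"
  shows "g \<in> G k (card (orbit (\<tau> ^^ k) x))"
    and "map (\<lambda>i. (\<tau> ^^ i) x) [0..<g] \<in> start_lists A (\<tau> ^^ k) x g"
proof -
  let ?\<sigma> = "\<tau> ^^ k" let ?l = "card (orbit ?\<sigma> x)" let ?m = "card (orbit \<tau> x)"
  have perm: "permutation \<tau>" "permutation ?\<sigma>"
    using assms permutation_funpow by (auto simp: permutation_permutes)
  have pos: "?m > 0" "?l > 0" by (rule card_orbit_pos[OF perm(1)], rule card_orbit_pos[OF perm(2)])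
  have g: "g = gcd ?m k"
    using card_orbit_funpow_gcd[OF perm(1), of k x] m pos by simp
  then show "g \<in> G k ?l"
    using m pos by (auto simp: G_def)
  have gpos: "g > 0" using m pos by (auto intro: Nat.gr0I)
  have card: "card (orbit ?\<sigma> ((\<tau> ^^ i) x)) = ?l" for i
  proof -
    \<comment> \<open>\<open>\<tau> ^^ i\<close> commutes with \<open>?\<sigma>\<close>, so it
      carries cycles of \<open>?\<sigma>\<close> to cycles of \<open>?\<sigma>\<close>.\<close>
    have "(\<tau> ^^ i) ` orbit ?\<sigma> x = orbit ?\<sigma> ((\<tau> ^^ i) x)"
      by (rule orbit_inverse[OF permutation_self_in_orbit[OF perm(2)]])
         (metis add.commute comp_apply funpow_add)
    moreover have "inj (\<tau> ^^ i)"
      using perm(1) by (intro inj_fn bij_is_inj permutation_bijective)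
    ultimately show ?thesis
      by (metis card_image inj_on_subset subset_UNIV)
  qed
  have "i = i'" if "i < g" "i' < g" "orbit ?\<sigma> ((\<tau> ^^ i) x) = orbit ?\<sigma> ((\<tau> ^^ i') x)" for i i'
  proof -
    have "(\<tau> ^^ i) x \<in> orbit ?\<sigma> ((\<tau> ^^ i') x)"
      using that(3) permutation_self_in_orbit[OF perm(2)] by blast
    then obtain n where "(\<tau> ^^ i) x = (?\<sigma> ^^ n) ((\<tau> ^^ i') x)"
      using orbit_altdef_permutation[OF perm(2)] by blast
    then have "(\<tau> ^^ i) x = (\<tau> ^^ (k * n + i')) x"
      by (simp add: funpow_mult funpow_add)
    then have "i mod ?m = (k * n + i') mod ?m"
      by (simp add: funpow_eq_iff_mod_card_orbit[OF perm(1)])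
    moreover have "g dvd ?m" "g dvd k" unfolding g by simp_all
    ultimately have "i mod g = (k * n + i') mod g"
      by (metis mod_mod_cancel)
    also have "\<dots> = i' mod g"
      using \<open>g dvd k\<close> by (auto elim!: dvdE simp: mult.assoc)
    finally show ?thesis using that by simp
  qed
  then have "distinct (map (\<lambda>i. orbit ?\<sigma> ((\<tau> ^^ i) x)) [0..<g])"
    by (auto simp: distinct_map inj_on_def)
  moreover have "(\<tau> ^^ i) x \<in> A" for i
    using assms(1,3) permutes_funpow permutes_in_image by metis
  ultimately show "map (\<lambda>i. (\<tau> ^^ i) x) [0..<g] \<in> start_lists A ?\<sigma> x g"
    using gpos card by (auto simp: start_lists_def comp_def)
qed

text \<open>Converse to \<open>root_start_list\<close>: the cycles of \<open>\<sigma>\<close> met by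
  \<open>ys\<close> are interleaved into one cyclic sequence \<open>z\<close> with
  \<open>z (i + g) = (\<sigma> ^^ j) (z i)\<close>.\<close>

lemma root_cycle_exists:
  fixes \<sigma> :: "'a \<Rightarrow> 'a"
  assumes "\<sigma> permutes A" and "finite A" and "k \<ge> 1"
    and l: "l = card (orbit \<sigma> x)" and G: "g \<in> G k l"
    and ys: "ys \<in> start_lists A \<sigma> x g"
  obtains \<rho> where "\<rho> permutes orbit \<rho> x" "card (orbit \<rho> x) = g * l"
    "\<And>y. y \<in> orbit \<rho> x \<Longrightarrow> (\<rho> ^^ k) y = \<sigma> y" "\<And>i. i < g \<Longrightarrow> (\<rho> ^^ i) x = ys ! i"
    "orbit \<rho> x = (\<Union>y\<in>set ys. orbit \<sigma> y)" "evenperm \<rho> \<longleftrightarrow> odd (g * l)"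
proof -
  have perm: "permutation \<sigma>"
    using assms by (auto simp: permutation_permutes)
  note g = G_props[OF G assms(3)]
  from g(3) obtain j where j: "(j * (k div g)) mod l = 1 mod l" by blast
  have lpos: "l > 0" using card_orbit_pos[OF perm] l by simp
  define k' where "k' = k div g"
  have k: "k = g * k'" using g(2) by (simp add: k'_def)
  have jk: "(j * k') mod l = 1 mod l" using j by (simp add: k'_def)
  have len: "length ys = g" and ys0: "ys ! 0 = x" and dist: "distinct (map (orbit \<sigma>) ys)"
    and sub: "set ys \<subseteq> {y \<in> A. card (orbit \<sigma> y) = l}"
    using ys l by (auto simp: start_lists_def)
  have in_ys: "ys ! (i mod g) \<in> set ys" for i
    using len g(1) by simp
  then have card_ys: "card (orbit \<sigma> (ys ! (i mod g))) = l" for i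
    using sub by blast
  \<comment> \<open>the orbit \<open>x, \<rho> x, \<rho>\<^sup>2 x, \<dots>\<close>, forced by \<open>\<rho>\<^sup>g = \<sigma>\<^sup>j\<close>\<close>
  define z where "z i = (\<sigma> ^^ (j * (i div g))) (ys ! (i mod g))" for i
  have orbit_z: "orbit \<sigma> (z i) = orbit \<sigma> (ys ! (i mod g))" for i
    unfolding z_def by (rule orbit_eq_orbit[OF perm funpow_in_own_orbit[OF perm]])
  \<comment> \<open>The cycle of \<open>\<sigma>\<close> containing \<open>z i\<close> reveals
    \<open>i mod g\<close>. The position in that cycle reveals \<open>i div g\<close> modulo
    \<open>l\<close>, as \<open>j\<close> is invertible there. So \<open>z\<close> has exact period
    \<open>g * l\<close>.\<close>
  have z_eq: "z i = z i' \<longleftrightarrow> i mod (g * l) = i' mod (g * l)" for i i'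
  proof -
    have "z i = z i' \<longleftrightarrow> i mod g = i' mod g \<and> (i div g) mod l = (i' div g) mod l"
    proof (cases "i mod g = i' mod g")
      case True
      have "coprime j l"
        using cong_imp_coprime[of 1 "j * k'" l] jk by (simp add: cong_def)
      have "z i = z i' \<longleftrightarrow> [j * (i div g) = j * (i' div g)] (mod l)"
        using True funpow_eq_iff_mod_card_orbit[OF perm] card_ys[of i']
        by (simp add: z_def cong_def)
      also have "\<dots> \<longleftrightarrow> [i div g = i' div g] (mod l)"
        by (rule cong_mult_lcancel_nat[OF \<open>coprime j l\<close>])
      finally show ?thesis using True by (simp add: cong_def)
    next
      case False
      then have "orbit \<sigma> (ys ! (i mod g)) \<noteq> orbit \<sigma> (ys ! (i' mod g))"
        using nth_eq_iff_index_eq[OF dist, of "i mod g" "i' mod g"] len g(1) by simp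
      then show ?thesis using False orbit_z by metis
    qed
    also have "\<dots> \<longleftrightarrow> i mod (g * l) = i' mod (g * l)"
    proof
      assume eq: "i mod (g * l) = i' mod (g * l)"
      then have "i mod g = i' mod g"
        by (metis dvd_triv_left mod_mod_cancel)
      then show "i mod g = i' mod g \<and> (i div g) mod l = (i' div g) mod l"
        using eq g(1) by (simp add: mod_mult2_eq)
    qed (simp add: mod_mult2_eq)
    finally show ?thesis .
  qed
  define cs where "cs = map z [0..<g * l]"
  have dist_cs: "distinct cs"
    by (auto simp: cs_def distinct_map inj_on_def z_eq)
  have len_cs: "length cs = g * l" by (simp add: cs_def)
  have glpos: "g * l > 0" using g(1) lpos by simp
  have nth_cs: "cs ! (i mod (g * l)) = z i" for i
    using glpos by (simp add: cs_def z_eq)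
  have set_cs: "set cs = range z"
  proof
    have "z i \<in> set cs" for i
      unfolding nth_cs[of i, symmetric] using glpos len_cs by (intro nth_mem) simp
    then show "range z \<subseteq> set cs" by blast
  qed (auto simp: cs_def)
  define \<rho> where "\<rho> = cycle_of_list cs"
  have perm_\<rho>: "permutation \<rho>" unfolding \<rho>_def by (rule permutation_of_cycle)
  have step: "\<rho> (z i) = z (Suc i)" for i
  proof -
    have "\<rho> (cs ! (i mod (g * l))) = map (\<rho> ^^ 1) cs ! (i mod (g * l))"
      using glpos len_cs by simp
    also have "\<dots> = rotate1 cs ! (i mod (g * l))"
      unfolding \<rho>_def cyclic_rotation[OF dist_cs] by simp
    also have "\<dots> = cs ! (Suc i mod (g * l))"
      using glpos len_cs by (simp add: nth_rotate1 mod_Suc_eq)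
    finally show ?thesis by (simp add: nth_cs)
  qed
  have steps: "(\<rho> ^^ n) (z i) = z (n + i)" for n i
    by (induction n) (simp_all add: step)
  have z0: "z 0 = x" by (simp add: z_def ys0)
  have pow: "(\<rho> ^^ n) x = z n" for n
    using steps[of n 0] z0 by simp
  have orbit_\<rho>: "orbit \<rho> x = range z"
    unfolding orbit_altdef_permutation[OF perm_\<rho>] pow by auto
  have root: "(\<rho> ^^ k) (z i) = \<sigma> (z i)" for i
  proof -
    \<comment> \<open>Advancing by \<open>k = g * k'\<close> raises the quotient by
      \<open>k'\<close>. This applies \<open>\<sigma>\<close> another \<open>j * k'\<close> times,
      which is 1 modulo \<open>l\<close>.\<close>
    have "(\<rho> ^^ k) (z i) = z (i + g * k')"
      by (simp add: steps k add.commute)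
    also have "\<dots> = (\<sigma> ^^ (j * k' + j * (i div g))) (ys ! (i mod g))"
      using g(1) by (simp add: z_def distrib_left)
    also have "\<dots> = (\<sigma> ^^ (j * k')) (z i)"
      by (simp add: z_def funpow_add)
    also have "\<dots> = (\<sigma> ^^ 1) (z i)"
      by (subst funpow_eq_iff_mod_card_orbit[OF perm]) (simp add: orbit_z card_ys jk)
    finally show ?thesis by simp
  qed
  have union: "range z = (\<Union>y\<in>set ys. orbit \<sigma> y)"
  proof
    show "range z \<subseteq> (\<Union>y\<in>set ys. orbit \<sigma> y)"
      using in_ys unfolding z_def by (auto intro!: funpow_in_own_orbit[OF perm])
    \<comment> \<open>By the root property \<open>\<sigma>\<close> maps \<open>z i\<close> to
      \<open>z (k + i)\<close>, so the range of \<open>z\<close> contains the whole cycle of each of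
      its points.\<close>
    have closed: "\<sigma> w \<in> range z" if "w \<in> range z" for w
    proof -
      from that obtain i where "w = z i" by blast
      then have "\<sigma> w = z (k + i)" using root[of i] steps[of k i] by simp
      then show ?thesis by blast
    qed
    have "orbit \<sigma> y \<subseteq> range z" if "y \<in> set ys" for y
    proof
      fix w assume "w \<in> orbit \<sigma> y"
      from \<open>y \<in> set ys\<close> obtain i where "i < g" "y = ys ! i"
        using len by (auto simp: in_set_conv_nth)
      then have "y = z i" by (simp add: z_def)
      then have "y \<in> range z" by blast
      with \<open>w \<in> orbit \<sigma> y\<close> show "w \<in> range z"
        by (induction) (auto intro: closed)
    qed
    then show "(\<Union>y\<in>set ys. orbit \<sigma> y) \<subseteq> range z" by blast
  qed
  show thesis
  proof (rule that[of \<rho>])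
    show "\<rho> permutes orbit \<rho> x"
      unfolding orbit_\<rho> set_cs[symmetric] unfolding \<rho>_def by (rule cycle_permutes)
    show "card (orbit \<rho> x) = g * l"
      unfolding orbit_\<rho> set_cs[symmetric] using distinct_card[OF dist_cs] len_cs by simp
    show "(\<rho> ^^ k) y = \<sigma> y" if "y \<in> orbit \<rho> x" for y
      using that root by (auto simp: orbit_\<rho>)
    show "(\<rho> ^^ i) x = ys ! i" if "i < g" for i
      using that by (simp add: pow z_def)
    show "orbit \<rho> x = (\<Union>y\<in>set ys. orbit \<sigma> y)"
      by (simp add: orbit_\<rho> union)
    have "cs \<noteq> []" using len_cs glpos by auto
    then show "evenperm \<rho> \<longleftrightarrow> odd (g * l)"
      unfolding \<rho>_def by (simp add: evenperm_cycle_of_list[OF dist_cs] len_cs)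
  qed
qed

section \<open>Counting start lists\<close>

lemma card_lists_distinct_images:
  assumes "finite B" and fib: "\<And>C. C \<in> f ` B \<Longrightarrow> card {y \<in> B. f y = C} = l"
  shows "card {zs. length zs = m \<and> set zs \<subseteq> B \<and> distinct (map f zs)} = l ^ m * (\<Prod>i<m. card (f ` B) - i)"
proof (induction m)
  case 0
  have "{zs. length zs = 0 \<and> set zs \<subseteq> B \<and> distinct (map f zs)} = {[]}" by auto
  then show ?case by simp
next
  case (Suc m)
  define S where "S = (\<lambda>m. {zs. length zs = m \<and> set zs \<subseteq> B \<and> distinct (map f zs)})"
  have fin: "finite (S m)"
    by (rule finite_subset[OF _ finite_lists_length_eq[OF assms(1), of m]]) (auto simp: S_def)
  \<comment> \<open>The head of a longer list must avoid the \<open>m\<close> fibres already met,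
    and each remaining fibre offers \<open>l\<close> points.\<close>
  have new: "card {y \<in> B. f y \<notin> f ` set zs} = l * (card (f ` B) - m)" if "zs \<in> S m" for zs
  proof -
    have zs: "length zs = m" "set zs \<subseteq> B" "distinct (map f zs)" using that by (auto simp: S_def)
    have "{y \<in> B. f y \<notin> f ` set zs} = (\<Union>C\<in>f ` B - f ` set zs. {y \<in> B. f y = C})" by (auto simp: image_iff) metis
    also have "card \<dots> = (\<Sum>C\<in>f ` B - f ` set zs. card {y \<in> B. f y = C})"
      using assms(1) by (intro card_UN_disjoint) auto
    also have "\<dots> = card (f ` B - f ` set zs) * l"
      using fib by simp
    also have "card (f ` B - f ` set zs) = card (f ` B) - card (f ` set zs)"
      using zs(2) by (intro card_Diff_subset) auto
    also have "card (f ` set zs) = m"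
      using distinct_card[OF zs(3)] zs(1) by simp
    finally show ?thesis by (simp add: mult.commute)
  qed
  have "S (Suc m) = (\<lambda>(zs, y). y # zs) ` (SIGMA zs:S m. {y \<in> B. f y \<notin> f ` set zs})"
    by (auto simp: S_def length_Suc_conv image_iff)
  also have "card \<dots> = card (SIGMA zs:S m. {y \<in> B. f y \<notin> f ` set zs})"
    by (rule card_image) (auto simp: inj_on_def)
  also have "\<dots> = (\<Sum>zs\<in>S m. card {y \<in> B. f y \<notin> f ` set zs})"
    using fin assms(1) by (intro card_SigmaI) auto
  also have "\<dots> = card (S m) * (l * (card (f ` B) - m))"
    using new by simp
  finally show ?case
    using Suc by (simp add: S_def mult_ac)
qed

text \<open>The cycle type over an arbitrary ground set, since the induction removes cycles from
  \<open>{1..n}\<close>.\<close>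

definition num_cycles :: "'a set \<Rightarrow> ('a \<Rightarrow> 'a) \<Rightarrow> nat \<Rightarrow> nat" where
  "num_cycles A \<sigma> i = card {C \<in> orbit \<sigma> ` A. card C = i}"

text \<open>The head \<open>x\<close> is fixed. The other \<open>g - 1\<close> entries pick, in
  order, distinct cycles among the remaining ones of length \<open>l\<close>, and one of
  \<open>l\<close> points in each.\<close>

lemma card_start_lists:
  assumes "\<sigma> permutes A" and "finite A" and "x \<in> A" and "l = card (orbit \<sigma> x)" and "g \<ge> 1"
  shows "card (start_lists A \<sigma> x g) = l ^ (g - 1) * (\<Prod>i<g - 1. num_cycles A \<sigma> l - 1 - i)"
proof -
  have perm: "permutation \<sigma>" using assms by (auto simp: permutation_permutes)
  let ?B = "{y \<in> A. card (orbit \<sigma> y) = l \<and> orbit \<sigma> y \<noteq> orbit \<sigma> x}"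
  have im: "orbit \<sigma> ` ?B = {C \<in> orbit \<sigma> ` A. card C = l} - {orbit \<sigma> x}" by auto
  have fib: "card {y \<in> ?B. orbit \<sigma> y = C} = l" if "C \<in> orbit \<sigma> ` ?B" for C
  proof -
    from that obtain y where y: "y \<in> ?B" "C = orbit \<sigma> y" by blast
    have "{w \<in> ?B. orbit \<sigma> w = C} = C"
    proof (intro set_eqI iffI)
      fix w assume "w \<in> {w \<in> ?B. orbit \<sigma> w = C}"
      then show "w \<in> C" using permutation_self_in_orbit[OF perm] by blast
    next
      fix w assume w: "w \<in> C"
      then have "orbit \<sigma> w = C" using orbit_eq_orbit[OF perm] y by blast
      moreover have "w \<in> A" using w y permutes_orbit_subset[OF assms(1)] by blast
      ultimately show "w \<in> {w \<in> ?B. orbit \<sigma> w = C}" using y by auto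
    qed
    then show ?thesis using y by auto
  qed
  have "start_lists A \<sigma> x g
      = (#) x ` {zs. length zs = g - 1 \<and> set zs \<subseteq> ?B \<and> distinct (map (orbit \<sigma>) zs)}"
  proof (intro set_eqI iffI)
    fix ys assume ys: "ys \<in> start_lists A \<sigma> x g"
    then obtain zs where "ys = x # zs"
      using assms(5) by (cases ys) (auto simp: start_lists_def)
    with ys assms(4) have "length zs = g - 1" "distinct (map (orbit \<sigma>) zs)" "set zs \<subseteq> ?B"
      by (auto simp: start_lists_def image_iff subset_iff)
    then show "ys \<in> (#) x ` {zs. length zs = g - 1 \<and> set zs \<subseteq> ?B \<and> distinct (map (orbit \<sigma>) zs)}"
      using \<open>ys = x # zs\<close> by blast
  next
    fix ys assume "ys \<in> (#) x ` {zs. length zs = g - 1 \<and> set zs \<subseteq> ?B \<and> distinct (map (orbit \<sigma>) zs)}"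
    then obtain zs where zs: "ys = x # zs" "length zs = g - 1" "set zs \<subseteq> ?B" "distinct (map (orbit \<sigma>) zs)"
      by blast
    then have "orbit \<sigma> x \<notin> orbit \<sigma> ` set zs" by fastforce
    with zs assms(3-5) show "ys \<in> start_lists A \<sigma> x g" by (auto simp: start_lists_def)
  qed
  then have "card (start_lists A \<sigma> x g)
      = card {zs. length zs = g - 1 \<and> set zs \<subseteq> ?B \<and> distinct (map (orbit \<sigma>) zs)}"
    by (simp add: card_image)
  also have "\<dots> = l ^ (g - 1) * (\<Prod>i<g - 1. card (orbit \<sigma> ` ?B) - i)"
    by (rule card_lists_distinct_images) (use assms(2) fib in auto)
  also have "card (orbit \<sigma> ` ?B) = num_cycles A \<sigma> l - 1"
    unfolding im num_cycles_def using assms by (subst card_Diff_singleton) auto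
  finally show ?thesis .
qed

lemma prod_diff_mult_fact:
  assumes "m \<le> a"
  shows "(\<Prod>i<m. a - i) * fact (a - m) = (fact a :: nat)"
  using assms
proof (induction m)
  case (Suc m)
  then have "fact (a - m) = (a - m) * (fact (a - Suc m) :: nat)"
    by (metis Suc_diff_Suc Suc_le_lessD diff_Suc_1 fact_nonzero fact_reduce of_nat_id zero_less_diff)
  with Suc show ?case by (simp add: mult.assoc)
qed simp

section \<open>Splitting off one cycle of a root\<close>

lemma perm_restrict_funpow:
  assumes "\<And>y. y \<in> T \<Longrightarrow> f y \<in> T"
  shows "perm_restrict f T ^^ n = perm_restrict (f ^^ n) T"
proof
  fix y
  show "(perm_restrict f T ^^ n) y = perm_restrict (f ^^ n) T y"
  proof (cases "y \<in> T")
    case True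
    have "(perm_restrict f T ^^ n) y = (f ^^ n) y \<and> (f ^^ n) y \<in> T"
      using True assms by (induction n) (auto simp: perm_restrict_def)
    then show ?thesis using True by (simp add: perm_restrict_def)
  next
    case False
    then show ?thesis by (induction n) (auto simp: perm_restrict_def)
  qed
qed

text \<open>An injection of a finite set into itself is onto, so no point outside \<open>B\<close>
  is mapped into \<open>B\<close>.\<close>

lemma permutes_invariant_Diff:
  assumes "f permutes S" and "finite B" and "B \<subseteq> S" and "\<And>y. y \<in> B \<Longrightarrow> f y \<in> B"
  shows "f ` (S - B) = S - B" and "perm_restrict f (S - B) permutes (S - B)"
proof -
  have inj: "inj f" using assms(1) by (rule permutes_inj)
  then have "f ` B = B"
    using assms by (intro endo_inj_surj) (auto intro: inj_on_subset)
  then show img: "f ` (S - B) = S - B"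
    using permutes_image[OF assms(1)] by (simp add: image_set_diff[OF inj])
  have "bij_betw (perm_restrict f (S - B)) (S - B) (S - B)"
    using inj img by (auto simp: bij_betw_def perm_restrict_def inj_on_def inj_def)
  then show "perm_restrict f (S - B) permutes (S - B)"
    by (rule bij_imp_permutes) (auto simp: perm_restrict_def)
qed

lemma funpow_comp_disjoint:
  assumes "\<rho> permutes B" and "\<tau> permutes T" and "B \<inter> T = {}"
  shows "((\<rho> \<circ> \<tau>) ^^ n) y = (if y \<in> B then (\<rho> ^^ n) y else (\<tau> ^^ n) y)"
proof (induction n)
  case (Suc n)
  have "(\<rho> ^^ n) y \<in> B \<longleftrightarrow> y \<in> B"
    by (rule permutes_in_image[OF permutes_funpow[OF assms(1)]])
  moreover have "(\<tau> ^^ m) y \<notin> B" if "y \<notin> B" for m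
    using that assms permutes_in_image[OF permutes_funpow[OF assms(2), of m], of y]
      permutes_not_in[OF permutes_funpow[OF assms(2), of m], of y] by (cases "y \<in> T") auto
  from this[of "Suc n"] have "\<rho> (\<tau> ((\<tau> ^^ n) y)) = \<tau> ((\<tau> ^^ n) y)" if "y \<notin> B"
    using that permutes_not_in[OF assms(1)] by simp
  moreover have "\<tau> w = w" if "w \<in> B" for w
    using that assms(2,3) by (auto intro: permutes_not_in)
  ultimately show ?case using Suc by simp
qed simp

definition kth_roots :: "nat \<Rightarrow> 'a set \<Rightarrow> ('a \<Rightarrow> 'a) \<Rightarrow> ('a \<Rightarrow> 'a) set" where
  "kth_roots k A \<sigma> = {\<tau>. \<tau> permutes A \<and> \<tau> ^^ k = \<sigma>}"

text \<open>The start list forces the cycle through \<open>x\<close> to be that of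
  \<open>\<rho>\<close>, while outside \<open>B\<close> any root of the rest of
  \<open>\<sigma>\<close> may be chosen.\<close>

lemma kth_roots_with_start_list:
  assumes \<sigma>: "\<sigma> permutes A" and fin: "finite A" and "k \<ge> 1"
    and l: "l = card (orbit \<sigma> x)" and G: "g \<in> G k l"
    and ys: "ys \<in> start_lists A \<sigma> x g"
    and B: "B = (\<Union>y\<in>set ys. orbit \<sigma> y)"
  shows "\<exists>\<rho>. \<rho> permutes B \<and> (evenperm \<rho> \<longleftrightarrow> odd (g * l)) \<and>
    {\<tau> \<in> kth_roots k A \<sigma>. card (orbit \<tau> x) = g * l \<and> map (\<lambda>i. (\<tau> ^^ i) x) [0..<g] = ys}
      = (\<circ>) \<rho> ` kth_roots k (A - B) (perm_restrict \<sigma> (A - B))" (is "\<exists>\<rho>. _ \<and> _ \<and> ?L = ?R \<rho>")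
proof -
  from root_cycle_exists[OF assms(1-6)] obtain \<rho> where \<rho>: "\<rho> permutes orbit \<rho> x"
    "card (orbit \<rho> x) = g * l" "\<And>y. y \<in> orbit \<rho> x \<Longrightarrow> (\<rho> ^^ k) y = \<sigma> y"
    "\<And>i. i < g \<Longrightarrow> (\<rho> ^^ i) x = ys ! i"
    "orbit \<rho> x = (\<Union>y\<in>set ys. orbit \<sigma> y)" "evenperm \<rho> \<longleftrightarrow> odd (g * l)"
    by metis
  have OB: "orbit \<rho> x = B" using \<rho>(5) B by simp
  have BA: "B \<subseteq> A"
    using ys permutes_orbit_subset[OF \<sigma>] unfolding B start_lists_def by blast
  have finB: "finite B" using BA fin finite_subset by blast
  have perm_\<rho>: "permutation \<rho>"
    using \<rho>(1) OB finB by (auto simp: permutation_permutes)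
  have xB: "x \<in> B" using permutation_self_in_orbit[OF perm_\<rho>] OB by blast
  have pow_B: "(\<rho> ^^ n) x \<in> B" for n
    using funpow_in_own_orbit[OF perm_\<rho>] OB by blast
  have len: "length ys = g" using ys by (simp add: start_lists_def)
  have "?L = ?R \<rho>"
  proof (intro equalityI subsetI)
    fix \<tau> assume "\<tau> \<in> ?L"
    then have \<tau>: "\<tau> permutes A" "\<tau> ^^ k = \<sigma>" "card (orbit \<tau> x) = g * l"
      "map (\<lambda>i. (\<tau> ^^ i) x) [0..<g] = ys" by (auto simp: kth_roots_def)
    have perm_\<tau>: "permutation \<tau>" using \<tau>(1) fin by (auto simp: permutation_permutes)
    have prefix: "(\<tau> ^^ i) x = (\<rho> ^^ i) x" if "i < g" for i
      using that arg_cong[OF \<tau>(4), of "\<lambda>zs. zs ! i"] \<rho>(4)[OF that] by simp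
    have agree: "(\<tau> ^^ i) x = (\<rho> ^^ i) x" for i
    proof (rule root_determined_by_prefix[OF perm_\<tau> perm_\<rho> \<tau>(3) \<rho>(2) G \<open>k \<ge> 1\<close> _ _ prefix])
      show "(\<tau> ^^ k) ((\<tau> ^^ i) x) = \<sigma> ((\<tau> ^^ i) x)" for i
        by (simp only: \<tau>(2))
      show "(\<rho> ^^ k) ((\<rho> ^^ i) x) = \<sigma> ((\<rho> ^^ i) x)" for i
        by (rule \<rho>(3)) (simp only: OB pow_B)
    qed
    \<comment> \<open>Every point of \<open>B\<close> is some \<open>(\<rho> ^^ i) x\<close>;
      agreement at \<open>i\<close> and at \<open>Suc i\<close> gives it the same image under both
      permutations.\<close>
    have \<tau>_B: "\<tau> y = \<rho> y" if "y \<in> B" for y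
    proof -
      from that obtain i where "y = (\<rho> ^^ i) x"
        unfolding OB[symmetric] orbit_altdef_permutation[OF perm_\<rho>] by blast
      then show ?thesis using agree[of i] agree[of "Suc i"] by simp
    qed
    then have inv: "\<tau> y \<in> B" if "y \<in> B" for y
      using that \<rho>(1) OB permutes_in_image by metis
    note rest = permutes_invariant_Diff[OF \<tau>(1) finB BA inv]
    let ?\<tau>' = "perm_restrict \<tau> (A - B)"
    have "?\<tau>' ^^ k = perm_restrict \<sigma> (A - B)"
      unfolding \<tau>(2)[symmetric] by (rule perm_restrict_funpow) (use rest(1) in blast)
    then have "?\<tau>' \<in> kth_roots k (A - B) (perm_restrict \<sigma> (A - B))"
      using rest(2) by (simp add: kth_roots_def)
    moreover have "\<tau> = \<rho> \<circ> ?\<tau>'"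
    proof
      fix y
      consider "y \<in> B" | "y \<in> A - B" | "y \<notin> A" "y \<notin> B" using BA by blast
      then show "\<tau> y = (\<rho> \<circ> ?\<tau>') y"
      proof cases
        case 1 then show ?thesis using \<tau>_B by (simp add: perm_restrict_def)
      next
        case 2
        then have "\<tau> y \<notin> B" using rest(1) by blast
        then show ?thesis using 2 permutes_not_in[OF \<rho>(1)] OB by (simp add: perm_restrict_def)
      next
        case 3
        then show ?thesis using permutes_not_in[OF \<rho>(1)] permutes_not_in[OF \<tau>(1)] OB
          by (simp add: perm_restrict_def)
      qed
    qed
    ultimately show "\<tau> \<in> ?R \<rho>" by blast
  next
    fix \<tau> assume "\<tau> \<in> ?R \<rho>"
    then obtain \<tau>' where \<tau>': "\<tau>' permutes A - B" "\<tau>' ^^ k = perm_restrict \<sigma> (A - B)" "\<tau> = \<rho> \<circ> \<tau>'"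
      by (auto simp: kth_roots_def)
    have pow: "(\<tau> ^^ n) y = (if y \<in> B then (\<rho> ^^ n) y else (\<tau>' ^^ n) y)" for n y
      unfolding \<tau>'(3) by (rule funpow_comp_disjoint[OF _ \<tau>'(1)]) (use \<rho>(1) OB in auto)
    have perm: "\<tau> permutes A"
      unfolding \<tau>'(3) using \<rho>(1) \<tau>'(1) BA OB by (intro permutes_compose) (auto intro: permutes_subset)
    have "\<tau> ^^ k = \<sigma>"
    proof
      fix y show "(\<tau> ^^ k) y = \<sigma> y"
        using \<rho>(3)[of y] OB BA \<tau>'(2) permutes_not_in[OF \<sigma>, of y] by (auto simp: pow perm_restrict_def)
    qed
    moreover have "orbit \<tau> x = orbit \<rho> x"
      using perm fin xB by (simp add: orbit_altdef_permutation[OF perm_\<rho>] pow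
        orbit_altdef_permutation[of \<tau>] permutation_permutes exI[of _ A])
    moreover have "map (\<lambda>i. (\<tau> ^^ i) x) [0..<g] = ys"
      by (rule nth_equalityI) (use len xB \<rho>(4) in \<open>auto simp: pow\<close>)
    ultimately show "\<tau> \<in> ?L" using perm \<rho>(2) by (simp add: kth_roots_def)
  qed
  then show ?thesis using \<rho>(1,6) OB by blast
qed

text \<open>\<open>B\<close> consists of whole cycles, so restriction leaves the other orbits
  intact; the entries of \<open>ys\<close> lie in \<open>g\<close> distinct cycles of length
  \<open>l\<close>.\<close>

lemma num_cycles_remove:
  assumes \<sigma>: "\<sigma> permutes A" and fin: "finite A"
    and l: "l = card (orbit \<sigma> x)"
    and ys: "ys \<in> start_lists A \<sigma> x g"
    and B: "B = (\<Union>y\<in>set ys. orbit \<sigma> y)"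
  shows "perm_restrict \<sigma> (A - B) permutes (A - B)"
    and "num_cycles (A - B) (perm_restrict \<sigma> (A - B)) i
      = num_cycles A \<sigma> i - (if i = l then g else 0)"
    and "g \<le> num_cycles A \<sigma> l"
proof -
  have perm: "permutation \<sigma>" using assms by (auto simp: permutation_permutes)
  have BA: "B \<subseteq> A"
    using ys permutes_orbit_subset[OF \<sigma>] unfolding B start_lists_def by blast
  have finB: "finite B" using BA fin finite_subset by blast
  have inv: "\<sigma> y \<in> B" if "y \<in> B" for y
    using that unfolding B by (auto intro: orbit.step)
  note rest = permutes_invariant_Diff[OF \<sigma> finB BA inv]
  show "perm_restrict \<sigma> (A - B) permutes (A - B)" by (rule rest(2))
  have in_B: "y \<in> B \<longleftrightarrow> orbit \<sigma> y \<in> orbit \<sigma> ` set ys" for y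
    unfolding B using orbit_eq_orbit[OF perm] permutation_self_in_orbit[OF perm] by blast
  have "orbit (perm_restrict \<sigma> (A - B)) y = orbit \<sigma> y" if "y \<in> A - B" for y
    by (rule orbit_cong0[OF that, symmetric]) (use rest(1) in \<open>auto simp: perm_restrict_def\<close>)
  then have "orbit (perm_restrict \<sigma> (A - B)) ` (A - B) = orbit \<sigma> ` (A - B)" by auto
  also have "\<dots> = orbit \<sigma> ` A - orbit \<sigma> ` set ys" using in_B by blast
  finally have cycles: "orbit (perm_restrict \<sigma> (A - B)) ` (A - B) = orbit \<sigma> ` A - orbit \<sigma> ` set ys" .
  have sub: "orbit \<sigma> ` set ys \<subseteq> {C \<in> orbit \<sigma> ` A. card C = l}"
    using ys l by (auto simp: start_lists_def)
  have card: "card (orbit \<sigma> ` set ys) = g"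
    using ys distinct_card[of "map (orbit \<sigma>) ys"] by (simp add: start_lists_def)
  show "g \<le> num_cycles A \<sigma> l"
    unfolding card[symmetric] num_cycles_def by (rule card_mono[OF _ sub]) (use fin in auto)
  show "num_cycles (A - B) (perm_restrict \<sigma> (A - B)) i
      = num_cycles A \<sigma> i - (if i = l then g else 0)"
  proof (cases "i = l")
    case True
    have "{C \<in> orbit \<sigma> ` A - orbit \<sigma> ` set ys. card C = l}
        = {C \<in> orbit \<sigma> ` A. card C = l} - orbit \<sigma> ` set ys" by blast
    then show ?thesis
      using True sub card by (simp add: num_cycles_def cycles card_Diff_subset)
  next
    case False
    then have "{C \<in> orbit \<sigma> ` A - orbit \<sigma> ` set ys. card C = i} = {C \<in> orbit \<sigma> ` A. card C = i}"
      using sub by auto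
    then show ?thesis using False by (simp add: num_cycles_def cycles)
  qed
qed

subsection \<open>The weighted number of roots\<close>

text \<open>The weight \<open>u = 1\<close> counts all roots, and \<open>u = -1\<close> counts them with sign.\<close>

lemma weighted_root_count:
  fixes \<sigma> :: "'a \<Rightarrow> 'a" and u :: real
  assumes u: "u * u = 1" and k: "k \<ge> 1" and fin: "finite A" and "finite I"
    and "\<sigma> permutes A"
    and "\<And>i. Poly_Mapping.lookup \<alpha> i = num_cycles A \<sigma> i"
    and "\<And>i. i \<notin> I \<Longrightarrow> Poly_Mapping.lookup \<alpha> i = 0"
  shows "(\<Sum>\<tau>\<in>kth_roots k A \<sigma>. if evenperm \<tau> then 1 else u)
    = (\<Prod>i\<in>I. fact (Poly_Mapping.lookup \<alpha> i))
      * mfps_exp (root_exponent k (\<lambda>l g. u ^ (l * g + 1))) \<alpha>"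
  using fin assms(5-7)
proof (induction A arbitrary: \<sigma> \<alpha> rule: finite_psubset_induct)
  case (psubset A)
  note \<sigma> = \<open>\<sigma> permutes A\<close> and \<alpha> = psubset.prems(2) and I = psubset.prems(3)
  let ?E = "mfps_exp (root_exponent k (\<lambda>l g. u ^ (l * g + 1)))"
  define w :: "('a \<Rightarrow> 'a) \<Rightarrow> real" where "w = (\<lambda>\<tau>. if evenperm \<tau> then 1 else u)"
  show ?case
  proof (cases "A = {}")
    case True
    then have "\<sigma> = id" using \<sigma> by simp
    then have "kth_roots k A \<sigma> = {id}"
      using True by (auto simp: kth_roots_def)
    moreover have "\<alpha> = 0"
      by (rule poly_mapping_eqI) (simp add: \<alpha> num_cycles_def True)
    moreover have "?E 0 = 1"
      by (rule mfps_exp_0) (rule root_exponent_0)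
    ultimately show ?thesis by simp
  next
    case False
    then obtain x where x: "x \<in> A" by blast
    define l where "l = card (orbit \<sigma> x)"
    define c where "c = Poly_Mapping.lookup \<alpha> l"
    \<comment> \<open>The product over \<open>I\<close> is split at \<open>l\<close>, the only index
      whose exponent changes when cycles of length \<open>l\<close> are removed.\<close>
    define Q :: real where "Q = (\<Prod>i\<in>I - {l}. fact (Poly_Mapping.lookup \<alpha> i))"
    have finA: "finite A" by fact
    have perm: "permutation \<sigma>" using \<sigma> finA by (auto simp: permutation_permutes)
    have l: "l \<ge> 1" using card_orbit_pos[OF perm, of x] by (simp add: l_def)
    have c_eq: "c = num_cycles A \<sigma> l" by (simp add: c_def \<alpha>)
    have c: "c \<ge> 1"
    proof -
      have "{C \<in> orbit \<sigma> ` A. card C = l} \<noteq> {}" using x l_def by blast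
      moreover have "finite {C \<in> orbit \<sigma> ` A. card C = l}" using finA by simp
      ultimately have "card {C \<in> orbit \<sigma> ` A. card C = l} > 0" by (subst card_gt_0_iff) (rule conjI)
      then show ?thesis by (simp add: c_eq num_cycles_def)
    qed
    have lI: "l \<in> I" using I[of l] c by (auto simp: c_def)
    \<comment> \<open>Roots are grouped by the number \<open>g\<close> of cycles of
      \<open>\<sigma>\<close> fused in the cycle through \<open>x\<close>, together with its first
      \<open>g\<close> points.\<close>
    define h where "h = (\<lambda>\<tau>. (card (orbit \<tau> x) div l, map (\<lambda>i. (\<tau> ^^ i) x) [0..<card (orbit \<tau> x) div l]))"
    let ?R = "kth_roots k A \<sigma>"
    let ?Y = "start_lists A \<sigma> x"
    let ?T = "{g \<in> G k l. g \<le> c}"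
    have finR: "finite ?R"
      by (rule finite_subset[OF _ finite_permutations[OF finA]]) (auto simp: kth_roots_def)
    have finY: "finite (?Y g)" for g
      by (rule finite_subset[OF _ finite_lists_length_eq[OF finA, of g]]) (auto simp: start_lists_def)
    have length_eq: "card (orbit \<tau> x) = (card (orbit \<tau> x) div l) * l" if "\<tau> \<in> ?R" for \<tau>
    proof -
      have "permutation \<tau>" "\<tau> ^^ k = \<sigma>"
        using that finA by (auto simp: kth_roots_def permutation_permutes)
      then have "l dvd card (orbit \<tau> x)"
        using card_orbit_funpow_gcd[of \<tau> k x] unfolding l_def by (metis dvd_triv_left)
      then show ?thesis by simp
    qed
    have hR: "h ` ?R \<subseteq> (SIGMA g:G k l. ?Y g)"
    proof
      fix p assume "p \<in> h ` ?R"
      then obtain \<tau> where \<tau>: "\<tau> \<in> ?R" "p = h \<tau>" by blast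
      have "\<tau> permutes A" "\<tau> ^^ k = \<sigma>" using \<tau>(1) by (auto simp: kth_roots_def)
      with root_start_list[of \<tau> A x k "card (orbit \<tau> x) div l"] length_eq[OF \<tau>(1)] finA x k
      show "p \<in> (SIGMA g:G k l. ?Y g)"
        by (simp add: \<tau>(2) h_def l_def)
    qed
    have fibre: "sum w {\<tau> \<in> ?R. h \<tau> = (g, ys)}
        = u ^ (l * g + 1) * (fact (c - g) * Q * ?E (\<alpha> - Poly_Mapping.single l g))"
      if g: "g \<in> G k l" and ys: "ys \<in> ?Y g" for g ys
    proof -
      define B where "B = (\<Union>y\<in>set ys. orbit \<sigma> y)"
      let ?\<sigma>' = "perm_restrict \<sigma> (A - B)"
      from kth_roots_with_start_list[OF \<sigma> finA k l_def g ys B_def] obtain \<rho> where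
        \<rho>: "\<rho> permutes B" "evenperm \<rho> \<longleftrightarrow> odd (g * l)"
        "{\<tau> \<in> ?R. card (orbit \<tau> x) = g * l \<and> map (\<lambda>i. (\<tau> ^^ i) x) [0..<g] = ys}
          = (\<circ>) \<rho> ` kth_roots k (A - B) ?\<sigma>'" by blast
      note rest = num_cycles_remove[OF \<sigma> finA l_def ys B_def]
      have gpos: "g \<ge> 1" using g by (simp add: G_def)
      then have "set ys \<noteq> {}" "set ys \<subseteq> A" using ys by (auto simp: start_lists_def)
      then have "B \<noteq> {}" using orbit_nonempty[of \<sigma>] by (simp add: B_def)
      have BA: "B \<subseteq> A"
        unfolding B_def by (rule UN_least, rule permutes_orbit_subset[OF \<sigma>]) (use \<open>set ys \<subseteq> A\<close> in blast)
      with \<open>B \<noteq> {}\<close> have AB: "A - B \<subset> A" by blast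
      have finB: "finite B" using BA finA finite_subset by blast
      have perm_\<rho>: "permutation \<rho>" using \<rho>(1) finB by (auto simp: permutation_permutes)
      \<comment> \<open>A cycle of length \<open>l * g\<close> is even iff \<open>l * g + 1\<close>
        is even, and \<open>u * u = 1\<close> makes powers of \<open>u\<close> depend only on
        parity.\<close>
      have w_\<rho>: "w \<rho> = u ^ (l * g + 1)"
      proof -
        have even_pow: "u ^ m = 1" if "even m" for m
          using that u by (auto elim!: evenE simp: power_mult power2_eq_square)
        show ?thesis
          using \<rho>(2) even_pow[of "l * g"] even_pow[of "l * g + 1"]
          by (cases "even (l * g)") (simp_all add: w_def mult.commute[of g l])
      qed
      \<comment> \<open>Two odd factors have an even product, matching
        \<open>u * u = 1\<close>.\<close>
      have w_comp: "w (\<rho> \<circ> \<tau>) = w \<rho> * w \<tau>" if "\<tau> \<in> kth_roots k (A - B) ?\<sigma>'" for \<tau>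
      proof -
        have "permutation \<tau>" using that finA by (auto simp: kth_roots_def permutation_permutes)
        then show ?thesis using u by (simp add: w_def evenperm_comp[OF perm_\<rho>])
      qed
      have "{\<tau> \<in> ?R. h \<tau> = (g, ys)}
          = {\<tau> \<in> ?R. card (orbit \<tau> x) = g * l \<and> map (\<lambda>i. (\<tau> ^^ i) x) [0..<g] = ys}"
        using length_eq l by (auto simp: h_def)
      then have "sum w {\<tau> \<in> ?R. h \<tau> = (g, ys)} = sum w ((\<circ>) \<rho> ` kth_roots k (A - B) ?\<sigma>')"
        using \<rho>(3) by simp
      also have "\<dots> = (\<Sum>\<tau>\<in>kth_roots k (A - B) ?\<sigma>'. w (\<rho> \<circ> \<tau>))"
        by (rule sum.reindex_cong[OF _ refl refl])
           (use permutes_inj[OF \<rho>(1)] in \<open>auto intro!: inj_onI simp: fun_eq_iff inj_def\<close>)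
      also have "\<dots> = w \<rho> * (\<Sum>\<tau>\<in>kth_roots k (A - B) ?\<sigma>'. w \<tau>)"
        by (simp add: w_comp sum_distrib_left)
      \<comment> \<open>The induction hypothesis applies on \<open>A - B\<close>. The set
        \<open>I\<close> can stay fixed, because exponents that become 0 contribute
        \<open>fact 0 = 1\<close>.\<close>
      also have "(\<Sum>\<tau>\<in>kth_roots k (A - B) ?\<sigma>'. w \<tau>)
          = (\<Prod>i\<in>I. fact (Poly_Mapping.lookup (\<alpha> - Poly_Mapping.single l g) i)) * ?E (\<alpha> - Poly_Mapping.single l g)"
        unfolding w_def
        by (rule psubset.IH[OF AB rest(1)])
           (auto simp: lookup_minus lookup_single when_def rest(2) \<alpha> I simp flip: \<alpha>)
      also have "(\<Prod>i\<in>I. fact (Poly_Mapping.lookup (\<alpha> - Poly_Mapping.single l g) i)) = fact (c - g) * Q"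
        unfolding prod.remove[OF \<open>finite I\<close> lI] Q_def c_def
        by (auto simp: lookup_minus lookup_single when_def intro!: prod.cong)
      finally show ?thesis by (simp add: w_\<rho>)
    qed
    \<comment> \<open>The choices of cycles form a falling factorial of \<open>c - 1\<close> with
      \<open>g - 1\<close> factors; \<open>fact (c - g)\<close> completes it to
      \<open>fact (c - 1)\<close>.\<close>
    have count: "real (card (?Y g)) * fact (c - g) = real l ^ (g - 1) * fact (c - 1)"
      if "g \<in> ?T" for g
    proof -
      have g: "g \<ge> 1" "g \<le> c" using that by (auto simp: G_def)
      have "card (?Y g) * fact (c - g) = l ^ (g - 1) * ((\<Prod>i<g - 1. c - 1 - i) * fact (c - 1 - (g - 1)))"
        using card_start_lists[OF \<sigma> finA x l_def g(1)] g c_eq by (simp add: mult.assoc)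
      also have "\<dots> = l ^ (g - 1) * fact (c - 1)"
        using prod_diff_mult_fact[of "g - 1" "c - 1"] g by simp
      finally have "real (card (?Y g) * fact (c - g)) = real (l ^ (g - 1) * fact (c - 1))"
        by (rule arg_cong)
      then show ?thesis by simp
    qed
    have "sum w ?R = (\<Sum>p\<in>(SIGMA g:G k l. ?Y g). sum w {\<tau> \<in> ?R. h \<tau> = p})"
      by (rule sum.group[symmetric, OF finR _ hR]) (use finite_G[OF k] finY in auto)
    also have "\<dots> = (\<Sum>g\<in>G k l. \<Sum>ys\<in>?Y g. sum w {\<tau> \<in> ?R. h \<tau> = (g, ys)})"
      by (subst sum.Sigma) (use finite_G[OF k] finY in auto)
    also have "\<dots> = (\<Sum>g\<in>G k l. real (card (?Y g))
        * (u ^ (l * g + 1) * (fact (c - g) * Q * ?E (\<alpha> - Poly_Mapping.single l g))))"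
      by (intro sum.cong refl) (simp add: fibre)
    also have "\<dots> = (\<Sum>g\<in>?T. real (card (?Y g))
        * (u ^ (l * g + 1) * (fact (c - g) * Q * ?E (\<alpha> - Poly_Mapping.single l g))))"
    proof (rule sum.mono_neutral_right)
      \<comment> \<open>Only \<open>c\<close> cycles of length \<open>l\<close> exist, so no start
        list has more than \<open>c\<close> entries; this cuts the sum to the range of the
        recurrence.\<close>
      have "?Y g = {}" if "g > c" for g
        using num_cycles_remove(3)[OF \<sigma> finA l_def _ refl, of _ g] that c_eq by force
      then show "\<forall>g\<in>G k l - ?T. real (card (?Y g))
        * (u ^ (l * g + 1) * (fact (c - g) * Q * ?E (\<alpha> - Poly_Mapping.single l g))) = 0" by auto
    qed (use finite_G[OF k] in auto)
    also have "\<dots> = (\<Sum>g\<in>?T. (real (card (?Y g)) * fact (c - g))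
        * (u ^ (l * g + 1) * (Q * ?E (\<alpha> - Poly_Mapping.single l g))))"
      by (simp only: mult_ac)
    also have "\<dots> = (\<Sum>g\<in>?T. (real l ^ (g - 1) * fact (c - 1))
        * (u ^ (l * g + 1) * (Q * ?E (\<alpha> - Poly_Mapping.single l g))))"
      by (intro sum.cong refl) (simp only: count)
    also have "\<dots> = fact (c - 1) * Q * (\<Sum>g\<in>?T. u ^ (l * g + 1) * real l ^ (g - 1) * ?E (\<alpha> - Poly_Mapping.single l g))"
      by (simp add: sum_distrib_left mult_ac)
    \<comment> \<open>The recurrence supplies the factor \<open>c\<close> that turns
      \<open>fact (c - 1)\<close> into \<open>fact c\<close>.\<close>
    also have "(\<Sum>g\<in>?T. u ^ (l * g + 1) * real l ^ (g - 1) * ?E (\<alpha> - Poly_Mapping.single l g)) = real c * ?E \<alpha>"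
      unfolding c_def by (rule exp_root_exponent_recurrence[OF k l, symmetric])
    also have "fact (c - 1) * Q * (real c * ?E \<alpha>) = (fact c * Q) * ?E \<alpha>"
      using c fact_reduce[of c, where ?'a = real] by simp
    also have "fact c * Q = (\<Prod>i\<in>I. fact (Poly_Mapping.lookup \<alpha> i))"
      unfolding prod.remove[OF \<open>finite I\<close> lI] Q_def c_def by simp
    finally show ?thesis by (simp add: w_def)
  qed
qed

theorem theorem1:
  fixes k n :: nat and c :: "nat \<Rightarrow> nat" and \<sigma> :: "nat \<Rightarrow> nat"
  assumes "k \<ge> 1" and "n \<ge> 1"
    and "n = (\<Sum>i=1..n. i * c i)"
    and "\<sigma> permutes {1..n}" and "has_cycle_type n \<sigma> c"
  shows "real (card {\<tau>. \<tau> permutes {1..n} \<and> \<tau> ^^ k = \<sigma> \<and> evenperm \<tau>})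
           = egf_coeff (\<lambda>\<alpha>. 1/2 * mfps_exp (F_plus k) \<alpha> + 1/2 * mfps_exp (F_minus k) \<alpha>) n c
      \<and> real (card {\<tau>. \<tau> permutes {1..n} \<and> \<tau> ^^ k = \<sigma> \<and> \<not> evenperm \<tau>})
           = egf_coeff (\<lambda>\<alpha>. 1/2 * mfps_exp (F_plus k) \<alpha> - 1/2 * mfps_exp (F_minus k) \<alpha>) n c"
proof -
  let ?A = "{1..n}" and ?\<alpha> = "monom n c"
  let ?P = "\<Prod>i\<in>{1..n}. fact (c i) :: real"
  have lookup: "Poly_Mapping.lookup ?\<alpha> i = (if i \<in> {1..n} then c i else 0)" for i
    by (simp add: monom_def lookup_sum lookup_single when_def)
  have perm: "permutation \<sigma>" using assms(4) by (auto simp: permutation_permutes)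
  \<comment> \<open>The cycle type fixes the counts only for \<open>i\<close> in
    \<open>{1..n}\<close>. For other \<open>i\<close> both sides are 0, as every cycle is a nonempty
    subset of \<open>{1..n}\<close>.\<close>
  have cycles: "Poly_Mapping.lookup ?\<alpha> i = num_cycles ?A \<sigma> i" for i
  proof (cases "i \<in> {1..n}")
    case True
    have "cycles_of n \<sigma> = orbit \<sigma> ` {1..n}" by (auto simp: cycles_of_def)
    then show ?thesis
      using True assms(5) by (simp add: lookup num_cycles_def has_cycle_type_def)
  next
    case False
    have "card (orbit \<sigma> y) \<in> {1..n}" if "y \<in> ?A" for y
      using card_orbit_pos[OF perm, of y] card_mono[OF _ permutes_orbit_subset[OF assms(4) that]] by simp
    with False have "{C \<in> orbit \<sigma> ` ?A. card C = i} = {}" by auto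
    then show ?thesis using False by (simp only: lookup num_cycles_def card.empty if_False)
  qed
  define a where "a = real (card {\<tau>. \<tau> permutes {1..n} \<and> \<tau> ^^ k = \<sigma> \<and> evenperm \<tau>})"
  define b where "b = real (card {\<tau>. \<tau> permutes {1..n} \<and> \<tau> ^^ k = \<sigma> \<and> \<not> evenperm \<tau>})"
  have finR: "finite (kth_roots k ?A \<sigma>)"
    by (rule finite_subset[OF _ finite_permutations[of ?A]]) (auto simp: kth_roots_def)
  have counts: "(\<Sum>\<tau>\<in>kth_roots k ?A \<sigma>. if evenperm \<tau> then 1 else u) = a + u * b" for u :: real
    using finR by (simp add: sum.If_cases a_def b_def kth_roots_def Collect_conj_eq Int_assoc Compl_eq)
  have facts: "(\<Prod>i\<in>{1..n}. fact (Poly_Mapping.lookup ?\<alpha> i)) = ?P"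
    by (rule prod.cong) (auto simp: lookup)
  \<comment> \<open>One identity in \<open>u\<close> serves both series: \<open>u = 1\<close> adds
    the numbers of even and odd roots, \<open>u = -1\<close> subtracts them.\<close>
  have main: "a + u * b = ?P * mfps_exp (root_exponent k (\<lambda>l g. u ^ (l * g + 1))) ?\<alpha>"
    if "u * u = 1" for u
    unfolding counts[symmetric] facts[symmetric]
    by (rule weighted_root_count[OF that assms(1) _ _ assms(4) cycles]) (auto simp: lookup)
  have plus: "a + b = ?P * mfps_exp (F_plus k) ?\<alpha>"
    using main[of 1] by (simp add: F_plus_def)
  have minus: "a - b = ?P * mfps_exp (F_minus k) ?\<alpha>"
    using main[of "-1"] by (simp add: F_minus_def)
  have "a = ((a + b) + (a - b)) / 2" "b = ((a + b) - (a - b)) / 2" by simp_all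
  then show ?thesis
    unfolding a_def[symmetric] b_def[symmetric] egf_coeff_def plus minus
    by (simp add: algebra_simps add_divide_distrib diff_divide_distrib)
qed

end
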